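(* Let $\Pi_{\rm odd}$ be the map on $\mathbb{N}=\{1,2,3,\dots\}$ produced by the following procedure. At step $1$ set $\Pi_{\rm odd}(1)=1$. For $m=2,3,4,\dots$ in turn, at step $m$: if $m$ is odd or $\Pi_{\rm odd}(m-\lfloor m/2\rfloor)$ has been assigned at an earlier step, set $\Pi_{\rm odd}(m+\lfloor m/2\rfloor)=m$; otherwise set $\Pi_{\rm odd}(m-\lfloor m/2\rfloor)=m$. Let $n,k\ge1$ be natural numbers. Then: (a) $\Pi_{\rm odd}(n)$ never has type (I); (b) if $n=3k+1$ then $\Pi_{\rm odd}(n)$ has type (III); (c) if $n=3k+2$ then $\Pi_{\rm odd}(n)$ has type (II); (d) if $n=3k$ then $\Pi_{\rm odd}(n)$ has type (II) if $\Pi_{\rm odd}(k)$ has type (II), and $\Pi_{\rm odd}(n)$ has type (IV) if $\Pi_{\rm odd}(k)$ has type (III) or type (IV).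
   Context: The procedure assigns a value $\Pi_{\rm odd}(n)$ to every $n\in\mathbb{N}$. Types: $\Pi_{\rm odd}(n)$ has type (I) if $\Pi_{\rm odd}(n)>n$ and $\Pi_{\rm odd}(n)=2n-1$; type (II) if $\Pi_{\rm odd}(n)>n$ and $\Pi_{\rm odd}(n)=2n$; type (III) if $\Pi_{\rm odd}(n)<n$ and $\Pi_{\rm odd}(n)=(2n+1)/3$; type (IV) if $\Pi_{\rm odd}(n)<n$ and $\Pi_{\rm odd}(n)=2n/3$. *)

theory Defs
  imports Complex_Main
begin

definition odd_step :: "nat \<Rightarrow> (nat \<rightharpoonup> nat) \<Rightarrow> (nat \<rightharpoonup> nat)" where
  "odd_step m s =
     (if odd m \<or> s (m - m div 2) \<noteq> None
      then s(m + m div 2 \<mapsto> m)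
      else s(m - m div 2 \<mapsto> m))"

(* odd_state m: the assignments in force once steps 1, ..., m have been carried out. *)
fun odd_state :: "nat \<Rightarrow> (nat \<rightharpoonup> nat)" where
  "odd_state 0 = Map.empty"
| "odd_state (Suc 0) = [1 \<mapsto> 1]"
| "odd_state (Suc (Suc m)) = odd_step (Suc (Suc m)) (odd_state (Suc m))"

(* The value at n that the infinite procedure settles on; no step assigns a value at 0,
   so only arguments n >= 1 are meaningful. *)
definition Pi_odd :: "nat \<Rightarrow> nat" where
  "Pi_odd n = (THE v. \<exists>M. \<forall>m\<ge>M. odd_state m n = Some v)"

(* The equations are over the reals, so that neither subtraction nor division truncates. *)
definition type_I :: "(nat \<Rightarrow> nat) \<Rightarrow> nat \<Rightarrow> bool" where
  "type_I P n \<longleftrightarrow> P n > n \<and> real (P n) = 2 * real n - 1"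

definition type_II :: "(nat \<Rightarrow> nat) \<Rightarrow> nat \<Rightarrow> bool" where
  "type_II P n \<longleftrightarrow> P n > n \<and> real (P n) = 2 * real n"

definition type_III :: "(nat \<Rightarrow> nat) \<Rightarrow> nat \<Rightarrow> bool" where
  "type_III P n \<longleftrightarrow> P n < n \<and> real (P n) = (2 * real n + 1) / 3"

definition type_IV :: "(nat \<Rightarrow> nat) \<Rightarrow> nat \<Rightarrow> bool" where
  "type_IV P n \<longleftrightarrow> P n < n \<and> real (P n) = 2 * real n / 3"

end

(* A position n is filled early, by step (2n+1)/3 or 2n/3, or else by step 2n. Step 2j + 1 always
   fills 3j + 1, while step 2j fills 3j exactly when j was filled early, and j otherwise. So the
   value at n is determined recursively by n mod 3 and by the value at n div 3. *)
theory Submission imports Defs begin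

text \<open>The inequality encodes that position \<open>n div 3\<close> is filled early. The value
  at 0 is only a default.\<close>

fun closed_val :: "nat \<Rightarrow> nat" where
  "closed_val n =
     (if n = 0 then 0
      else if n mod 3 = 1 then (2 * n + 1) div 3
      else if n mod 3 = 0 \<and> closed_val (n div 3) < 2 * (n div 3) then 2 * (n div 3)
      else 2 * n)"

declare closed_val.simps [simp del]

lemma closed_val_3k1: "closed_val (3 * k + 1) = 2 * k + 1"
  by (subst closed_val.simps) simp

lemma closed_val_3k2: "closed_val (3 * k + 2) = 2 * (3 * k + 2)"
proof -
  have "(3 * k + 2) mod 3 = 2" by presburger
  then show ?thesis by (subst closed_val.simps) simp
qed

lemma closed_val_3k:
  assumes "k > 0"
  shows "closed_val (3 * k) = (if closed_val k < 2 * k then 2 * k else 6 * k)"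
  using assms by (subst closed_val.simps) simp

lemma nat_mod_3_cases:
  fixes n :: nat
  assumes "n > 0"
  obtains (0) k where "k > 0" "n = 3 * k" | (1) k where "n = 3 * k + 1" | (2) k where "n = 3 * k + 2"
proof -
  have "n = 3 * (n div 3) \<and> n div 3 > 0 \<or> n = 3 * (n div 3) + 1 \<or> n = 3 * (n div 3) + 2"
    using assms by presburger
  then show ?thesis using that by blast
qed

text \<open>Only residue 1 mod 3 yields odd values. This and the even case invert
  \<open>closed_val\<close>, finding the one position that a given step fills.\<close>

lemma closed_val_eq_odd_iff:
  assumes "n > 0"
  shows "closed_val n = 2 * j + 1 \<longleftrightarrow> n = 3 * j + 1"
  using assms
proof (cases n rule: nat_mod_3_cases)
  case (0 k)
  then have "even (closed_val n)" by (simp add: closed_val_3k)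
  with 0 show ?thesis by presburger
next
  case (1 k)
  then show ?thesis by (simp only: closed_val_3k1) simp
next
  case (2 k)
  then show ?thesis by (simp only: closed_val_3k2) presburger
qed

lemma closed_val_eq_even_iff:
  assumes "n > 0" "j > 0"
  shows "closed_val n = 2 * j \<longleftrightarrow> n = (if closed_val j < 2 * j then 3 * j else j)"
  using assms(1)
proof (cases n rule: nat_mod_3_cases)
  case (0 k)
  then show ?thesis
    \<comment> \<open>The value is \<open>2 * k\<close> or \<open>6 * k\<close>, so
      \<open>2 * j\<close> forces \<open>j = k\<close> (early) or \<open>j = n\<close>
      (late).\<close>
    using assms closed_val_3k[of k] closed_val_3k[of j] by (cases "j = n"; cases "j = k") auto
next
  case (1 k)
  then have val: "closed_val n = 2 * k + 1" by (simp only: closed_val_3k1)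
  have "n \<noteq> 3 * j" "closed_val n \<noteq> 2 * j" using 1(1) val by presburger+
  \<comment> \<open>Excludes \<open>n = j\<close> on the right-hand side: an early \<open>j\<close>
    selects \<open>3 * j\<close>.\<close>
  moreover have "closed_val n < 2 * n" using 1(1) val by simp
  ultimately show ?thesis by auto
next
  case (2 k)
  then have "closed_val n = 2 * n" by (simp only: closed_val_3k2)
  moreover have "n \<noteq> 3 * j" using 2 by presburger
  ultimately show ?thesis by auto
qed

text \<open>Step 1 also fits the general rule, since 1 is odd and
  \<open>1 + 1 div 2 = 1\<close>.\<close>

lemma odd_state_Suc: "odd_state (Suc m) = odd_step (Suc m) (odd_state m)"
  by (cases m) (simp_all add: odd_step_def)

text \<open>The invariant of the procedure: each step writes exactly the position whose closed value
  is the step number, so nothing is ever overwritten.\<close>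

lemma odd_state_closed:
  "odd_state m = (\<lambda>n. if n > 0 \<and> closed_val n \<le> m then Some (closed_val n) else None)"
proof (induction m)
  case 0
  have "closed_val n \<noteq> 0" if "n > 0" for n
    using that by (subst closed_val.simps) auto
  then show ?case by force
next
  case (Suc m)
  obtain p where p: "p > 0" "odd_step (Suc m) (odd_state m) = (odd_state m)(p \<mapsto> Suc m)"
    "\<And>n. n > 0 \<Longrightarrow> closed_val n = Suc m \<longleftrightarrow> n = p"
  proof (cases "odd (Suc m)")
    case True
    then obtain j where j: "Suc m = 2 * j + 1" by (elim oddE)
    have "odd_step (Suc m) (odd_state m) = (odd_state m)(3 * j + 1 \<mapsto> Suc m)"
      unfolding odd_step_def j by simp
    then show ?thesis using that[of "3 * j + 1"] closed_val_eq_odd_iff j by simp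
  next
    case False
    then obtain j where j: "Suc m = 2 * j" by (meson dvdE)
    then have "j > 0" by simp
    \<comment> \<open>The position tested in step \<open>2 * j\<close> is \<open>j\<close>, and
      \<open>m\<close> is \<open>2 * j - 1\<close>, so the bound \<open>\<le> m\<close> of the
      induction hypothesis becomes strict.\<close>
    have "odd_state m j \<noteq> None \<longleftrightarrow> closed_val j < 2 * j"
      using Suc.IH \<open>j > 0\<close> j by auto
    then have "odd_step (Suc m) (odd_state m) =
        (odd_state m)((if closed_val j < 2 * j then 3 * j else j) \<mapsto> Suc m)"
      unfolding odd_step_def j by simp
    then show ?thesis
      using that[of "if closed_val j < 2 * j then 3 * j else j"]
        closed_val_eq_even_iff \<open>j > 0\<close> j by simp
  qed
  show ?case
  proof
    fix n
    have "closed_val p = Suc m" using p(1,3) by blast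
    then show "odd_state (Suc m) n =
        (if n > 0 \<and> closed_val n \<le> Suc m then Some (closed_val n) else None)"
      unfolding odd_state_Suc p(2) unfolding Suc.IH using p(1) p(3)[of n]
      by (cases "n = p") (auto simp: le_Suc_eq)
  qed
qed

lemma Pi_odd_eq_closed_val:
  assumes "n > 0"
  shows "Pi_odd n = closed_val n"
  unfolding Pi_odd_def
proof (rule the_equality)
  show "\<exists>M. \<forall>m\<ge>M. odd_state m n = Some (closed_val n)"
    using assms by (auto simp: odd_state_closed)
next
  fix v
  assume "\<exists>M. \<forall>m\<ge>M. odd_state m n = Some v"
  \<comment> \<open>A time late enough both for \<open>v\<close> to have settled and for the closed
    form to be in force.\<close>
  then obtain M where "odd_state (max M (closed_val n)) n = Some v" by (meson max.cobounded1)
  then show "v = closed_val n"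
    using assms by (simp add: odd_state_closed)
qed

theorem theorem4:
  fixes n k :: nat
  assumes "n \<ge> 1" and "k \<ge> 1"
  shows "\<not> type_I Pi_odd n
    \<and> (n = 3 * k + 1 \<longrightarrow> type_III Pi_odd n)
    \<and> (n = 3 * k + 2 \<longrightarrow> type_II Pi_odd n)
    \<and> (n = 3 * k \<longrightarrow>
         (type_II Pi_odd k \<longrightarrow> type_II Pi_odd n)
         \<and> (type_III Pi_odd k \<or> type_IV Pi_odd k \<longrightarrow> type_IV Pi_odd n))"
proof (intro conjI impI)
  have Pi_n: "Pi_odd n = closed_val n" and Pi_k: "Pi_odd k = closed_val k"
    using assms by (simp_all add: Pi_odd_eq_closed_val)
  show "\<not> type_I Pi_odd n"
  proof
    assume "type_I Pi_odd n"
    then have "closed_val n > n" "closed_val n + 1 = 2 * n"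
      unfolding type_I_def Pi_n by linarith+
    \<comment> \<open>An odd value of this form forces \<open>n = 1\<close>, where the value is 1
      and does not exceed \<open>n\<close>.\<close>
    moreover have "closed_val n = 2 * (n - 1) + 1"
      using calculation(2) assms(1) by linarith
    then have "n = 3 * (n - 1) + 1"
      using closed_val_eq_odd_iff assms(1) by simp
    ultimately show False by linarith
  qed
  show "type_III Pi_odd n" if "n = 3 * k + 1"
    unfolding type_III_def Pi_n unfolding that closed_val_3k1 using assms by simp
  show "type_II Pi_odd n" if "n = 3 * k + 2"
    unfolding type_II_def Pi_n unfolding that closed_val_3k2 by simp
  show "type_II Pi_odd n" if "n = 3 * k" "type_II Pi_odd k"
    using that assms unfolding type_II_def Pi_n Pi_k by (simp add: closed_val_3k)
  \<comment> \<open>Both types put the value at \<open>k\<close> below \<open>k\<close>, hence below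
    \<open>2 * k\<close>, so \<open>k\<close> counts as early.\<close>
  show "type_IV Pi_odd n" if "n = 3 * k" "type_III Pi_odd k \<or> type_IV Pi_odd k"
    using that assms unfolding type_III_def type_IV_def Pi_n Pi_k by (auto simp: closed_val_3k)
qed

end
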